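(* Let $r$ and $n$ be integers such that $2 \le r \le n$ and $n \equiv 0 \pmod r$. For $k \ge 2$, if $F_1, F_2, \ldots, F_k$ are graphs on a common set of $n$ vertices, each of which consists of the vertex-disjoint union of $n/r$ copies of $K_r$, then \[ \gamma_{\rm sd}(F_1,F_2,\ldots,F_k) \le \left( 1 - \left( \frac{r-1}{r} \right) \left( \frac{1}{k} \right)^{\frac{1}{r-1}} \right) n \le \frac{n(\ln(k) + 1)}{r}. \]
   Context: All graphs are finite and simple. Given graphs $F_1,\ldots,F_k$ (called factors; not necessarily edge-disjoint) with common vertex set $V$, a set $S \subseteq V$ is a simultaneous dominating set if for every $i$, $1 \le i \le k$, every vertex not in $S$ is adjacent in $F_i$ to some vertex of $S$. The simultaneous domination number $\gamma_{\rm sd}(F_1,\ldots,F_k)$ is the minimum cardinality of a simultaneous dominating set. *)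

theory Defs
  imports Complex_Main "HOL-Library.Disjoint_Sets" "Graph_Theory.Graph_Theory"
begin

text \<open>
  A finite simple graph is a \<^locale>\<open>pair_graph\<close>: finite, loop-free and symmetric, so that
  each undirected edge is represented by its two opposite arcs.
\<close>

definition simult_dominating_set ::
  "'a set \<Rightarrow> nat \<Rightarrow> (nat \<Rightarrow> 'a pair_pre_digraph) \<Rightarrow> 'a set \<Rightarrow> bool" where
  "simult_dominating_set V k F S \<longleftrightarrow>
     S \<subseteq> V \<and> (\<forall>i\<in>{1..k}. \<forall>v\<in>V - S. \<exists>u\<in>S. v \<rightarrow>\<^bsub>with_proj (F i)\<^esub> u)"

text \<open>
  For finite \<open>V\<close> the minimum ranges over a finite set, which is nonempty because
  \<open>V\<close> itself is a simultaneous dominating set.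
\<close>

definition gamma_sd :: "'a set \<Rightarrow> nat \<Rightarrow> (nat \<Rightarrow> 'a pair_pre_digraph) \<Rightarrow> nat" where
  "gamma_sd V k F = Min (card ` {S. simult_dominating_set V k F S})"

definition disjoint_union_of_cliques :: "nat \<Rightarrow> nat \<Rightarrow> 'a pair_pre_digraph \<Rightarrow> bool" where
  "disjoint_union_of_cliques m r G \<longleftrightarrow>
     (\<exists>H :: nat \<Rightarrow> 'a pair_pre_digraph.
        (\<forall>j<m. K\<^bsub>r\<^esub> (with_proj (H j))) \<and>
        disjoint_family_on (\<lambda>j. pverts (H j)) {..<m} \<and>
        pverts G = (\<Union>j<m. pverts (H j)) \<and>
        parcs G = (\<Union>j<m. parcs (H j)))"

end

theory Submission
  imports Defs
begin

text \<open>
  Put each vertex into \<open>T\<close> independently with probability \<open>1 - q\<close>, and add one vertex of every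
  clique, in every factor, that \<open>T\<close> misses. The result dominates simultaneously and has expected
  size \<open>(1 - q) n + k (n / r) q\<^sup>r\<close>, which is minimal when \<open>k q\<^bsup>r - 1\<^esup> = 1\<close>. The second inequality
  is \<open>q = exp (- ln k / (r - 1)) \<ge> 1 - ln k / (r - 1)\<close>.
\<close>

text \<open>
  The choice of \<open>T\<close> is derandomised by conditional expectations: the right-hand side is the expected
  cost, and it is the \<open>(1 - q, q)\<close>-weighted mean of its values after deciding on one more vertex.
\<close>

lemma exists_subset_few_missed:
  fixes q :: real
  assumes "finite V" "finite I" "\<And>i. i \<in> I \<Longrightarrow> B i \<subseteq> V" "0 \<le> q" "q \<le> 1"
  shows "\<exists>T\<subseteq>V. real (card T) + real (card {i\<in>I. B i \<inter> T = {}})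
           \<le> (1 - q) * real (card V) + (\<Sum>i\<in>I. q ^ card (B i))"
  using assms(1-3)
proof (induction V arbitrary: I B rule: finite_induct)
  case empty
  \<comment> \<open>Every \<open>B i\<close> is empty here, so each index counts as missed and
    contributes \<open>q ^ 0 = 1\<close> on the right.\<close>
  then have "card {i\<in>I. B i \<inter> {} = {}} = card I" "(\<Sum>i\<in>I. q ^ card (B i)) = (\<Sum>i\<in>I. 1)"
    by (auto intro!: sum.cong)
  then show ?case by auto
next
  case (insert v V)
  define J where "J = {i\<in>I. v \<notin> B i}"
  define K where "K = {i\<in>I. v \<in> B i}"
  \<comment> \<open>\<open>1 + a\<close> is the expected cost once \<open>v\<close> is chosen:
    \<open>v\<close> itself costs 1 and the sets of \<open>K\<close> are met. \<open>a + b\<close>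
    is the expected cost once \<open>v\<close> is left out: the sets of \<open>K\<close> can then be
    met only in \<open>B i - {v}\<close>.\<close>
  define a where "a = (1 - q) * real (card V) + (\<Sum>i\<in>J. q ^ card (B i))"
  define b where "b = (\<Sum>i\<in>K. q ^ card (B i - {v}))"
  have fin: "finite J" "finite K" and I: "I = J \<union> K" "J \<inter> K = {}"
    using insert.prems(1) by (auto simp: J_def K_def)
  have finB: "finite (B i)" if "i \<in> I" for i
    using that insert.prems(2) insert.hyps(1) by (meson finite_insert finite_subset)
  have "q ^ card (B i) = q * q ^ card (B i - {v})" if "i \<in> K" for i
    using that finB by (metis (lifting) K_def card.remove mem_Collect_eq power_Suc)
  then have qb: "(\<Sum>i\<in>K. q ^ card (B i)) = q * b"
    by (simp add: b_def sum_distrib_left)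
  have goal: "(1 - q) * real (card (insert v V)) + (\<Sum>i\<in>I. q ^ card (B i))
      = (1 - q) * (1 + a) + q * (a + b)"
    using insert.hyps fin I qb by (simp add: a_def sum.union_disjoint algebra_simps)
  \<comment> \<open>Branch with \<open>v\<close> chosen: only the sets of \<open>J\<close> can still
    be missed, so the recursion runs on \<open>J\<close>.\<close>
  have "B i \<subseteq> V" if "i \<in> J" for i
    using that insert.prems(2) by (auto simp: J_def)
  from insert.IH[where I = J and B = B, OF fin(1) this] obtain T1 where T1: "T1 \<subseteq> V"
    "real (card T1) + real (card {i\<in>J. B i \<inter> T1 = {}}) \<le> a"
    unfolding a_def by blast
  \<comment> \<open>Branch with \<open>v\<close> left out: all indices stay, with \<open>v\<close>
    deleted from their sets. A set reduced to the empty set is certainly missed, in agreement with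
    its weight \<open>q ^ 0 = 1\<close>.\<close>
  have "B i - {v} \<subseteq> V" if "i \<in> I" for i
    using that insert.prems(2) by auto
  from insert.IH[where I = I and B = "\<lambda>i. B i - {v}", OF insert.prems(1) this] obtain T2 where T2: "T2 \<subseteq> V"
    "real (card T2) + real (card {i\<in>I. (B i - {v}) \<inter> T2 = {}})
      \<le> (1 - q) * real (card V) + (\<Sum>i\<in>I. q ^ card (B i - {v}))"
    by blast
  have "(\<Sum>i\<in>J. q ^ card (B i - {v})) = (\<Sum>i\<in>J. q ^ card (B i))"
    by (auto simp: J_def intro!: sum.cong)
  then have rhs2: "(1 - q) * real (card V) + (\<Sum>i\<in>I. q ^ card (B i - {v})) = a + b"
    using fin I by (simp add: a_def b_def sum.union_disjoint)
  have "{i\<in>I. (B i - {v}) \<inter> T2 = {}} = {i\<in>I. B i \<inter> T2 = {}}"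
    using T2(1) insert.hyps(2) by auto
  with T2 rhs2 have c2: "real (card T2) + real (card {i\<in>I. B i \<inter> T2 = {}}) \<le> a + b"
    by simp
  have "{i\<in>I. B i \<inter> insert v T1 = {}} = {i\<in>J. B i \<inter> T1 = {}}"
    by (auto simp: J_def)
  moreover have "card (insert v T1) = Suc (card T1)"
    using T1(1) insert.hyps by (meson card_insert_disjoint finite_subset subsetD)
  ultimately have c1: "real (card (insert v T1)) + real (card {i\<in>I. B i \<inter> insert v T1 = {}}) \<le> 1 + a"
    using T1(2) by simp
  \<comment> \<open>A weighted mean is at least the smaller of its two values, so one of the two
    branches stays within the bound.\<close>
  have "1 + a \<le> (1 - q) * (1 + a) + q * (a + b) \<or> a + b \<le> (1 - q) * (1 + a) + q * (a + b)"
  proof (cases "1 + a \<le> a + b")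
    case True
    then have "q * (1 + a) \<le> q * (a + b)"
      using assms(4) by (rule mult_left_mono)
    then show ?thesis by (simp add: algebra_simps)
  next
    case False
    then have "(1 - q) * (a + b) \<le> (1 - q) * (1 + a)"
      using assms(5) by (intro mult_left_mono) auto
    then show ?thesis by (simp add: algebra_simps)
  qed
  then show ?case
  proof
    assume "1 + a \<le> (1 - q) * (1 + a) + q * (a + b)"
    with c1 goal T1(1) show ?thesis by (intro exI[of _ "insert v T1"]) auto
  next
    assume "a + b \<le> (1 - q) * (1 + a) + q * (a + b)"
    with c2 goal T2(1) show ?thesis by (intro exI[of _ T2]) auto
  qed
qed

text \<open>Repair step: add to \<open>T\<close> one element of each set that it misses. This costs
  at most one vertex per missed set, and the bound on \<open>T\<close> has already paid for
  these.\<close>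

lemma exists_small_transversal:
  fixes q :: real
  assumes "finite V" "finite I" "\<And>i. i \<in> I \<Longrightarrow> B i \<subseteq> V" "\<And>i. i \<in> I \<Longrightarrow> B i \<noteq> {}"
    and "0 \<le> q" "q \<le> 1"
  shows "\<exists>S\<subseteq>V. (\<forall>i\<in>I. B i \<inter> S \<noteq> {}) \<and>
           real (card S) \<le> (1 - q) * real (card V) + (\<Sum>i\<in>I. q ^ card (B i))"
proof -
  obtain T where T: "T \<subseteq> V" "real (card T) + real (card {i\<in>I. B i \<inter> T = {}})
      \<le> (1 - q) * real (card V) + (\<Sum>i\<in>I. q ^ card (B i))"
    using exists_subset_few_missed[where I = I and B = B, OF assms(1-3,5,6)] by blast
  define c where "c i = (SOME x. x \<in> B i)" for i
  have c: "c i \<in> B i" if "i \<in> I" for i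
    using assms(4)[OF that] by (auto simp: c_def some_in_eq)
  define S where "S = T \<union> c ` {i\<in>I. B i \<inter> T = {}}"
  have "card S \<le> card T + card {i\<in>I. B i \<inter> T = {}}"
    unfolding S_def using assms(2)
    by (intro order_trans[OF card_Un_le] add_left_mono card_image_le) auto
  then have "real (card S) \<le> (1 - q) * real (card V) + (\<Sum>i\<in>I. q ^ card (B i))"
    using T(2) by linarith
  moreover have "S \<subseteq> V"
    using T(1) c assms(3) by (auto simp: S_def)
  moreover have "\<forall>i\<in>I. B i \<inter> S \<noteq> {}"
    using c unfolding S_def by blast
  ultimately show ?thesis by blast
qed

lemma gamma_sd_le_card:
  assumes "finite V" "simult_dominating_set V k F S"
  shows "gamma_sd V k F \<le> card S"
proof -
  have "{S. simult_dominating_set V k F S} \<subseteq> Pow V"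
    by (auto simp: simult_dominating_set_def)
  then have "finite {S. simult_dominating_set V k F S}"
    using assms(1) by (meson finite_Pow_iff finite_subset)
  then show ?thesis
    unfolding gamma_sd_def using assms(2) by (intro Min_le) auto
qed

text \<open>In each factor, a vertex outside \<open>S\<close> lies in some clique. The member of
  \<open>S\<close> in that clique is a different vertex, hence adjacent to it.\<close>

lemma simult_dominating_set_if_meets_cliques:
  assumes "S \<subseteq> V"
    and "\<And>i j. i \<in> {1..k} \<Longrightarrow> j < m \<Longrightarrow> K\<^bsub>r\<^esub> (with_proj (H i j))"
    and "\<And>i. i \<in> {1..k} \<Longrightarrow> V \<subseteq> (\<Union>j<m. pverts (H i j))"
    and "\<And>i j. i \<in> {1..k} \<Longrightarrow> j < m \<Longrightarrow> parcs (H i j) \<subseteq> parcs (F i)"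
    and "\<And>i j. i \<in> {1..k} \<Longrightarrow> j < m \<Longrightarrow> pverts (H i j) \<inter> S \<noteq> {}"
  shows "simult_dominating_set V k F S"
  unfolding simult_dominating_set_def
proof (intro conjI ballI)
  fix i v assume i: "i \<in> {1..k}" and v: "v \<in> V - S"
  then obtain j where j: "j < m" "v \<in> pverts (H i j)"
    using assms(3) by blast
  with assms(5)[OF i] obtain u where u: "u \<in> pverts (H i j)" "u \<in> S"
    by blast
  with v j assms(2)[OF i j(1)] have "(v, u) \<in> parcs (H i j)"
    by (auto simp: complete_digraph_pair_def)
  with assms(4)[OF i j(1)] u(2) show "\<exists>u\<in>S. v \<rightarrow>\<^bsub>with_proj (F i)\<^esub> u"
    by (auto simp: arcs_ends_def arc_to_ends_def)
qed (use assms(1) in auto)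

theorem theorem13:
  fixes r n k :: nat
    and V :: "'a set"
    and F :: "nat \<Rightarrow> 'a pair_pre_digraph"
  assumes "2 \<le> r" and "r \<le> n" and "n mod r = 0"
    and "2 \<le> k"
    and "card V = n"
    and "\<And>i. i \<in> {1..k} \<Longrightarrow> pair_graph (F i)"
    and "\<And>i. i \<in> {1..k} \<Longrightarrow> pverts (F i) = V"
    and "\<And>i. i \<in> {1..k} \<Longrightarrow> disjoint_union_of_cliques (n div r) r (F i)"
  shows "real (gamma_sd V k F)
           \<le> (1 - ((real r - 1) / real r) * (1 / real k) powr (1 / (real r - 1))) * real n
       \<and> (1 - ((real r - 1) / real r) * (1 / real k) powr (1 / (real r - 1))) * real n
           \<le> real n * (ln (real k) + 1) / real r"
proof -
  define q where "q = (1 / real k) powr (1 / (real r - 1))"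
  have q01: "0 \<le> q" "q \<le> 1"
    using assms(1,4) by (auto simp: q_def powr_le1)
  have "q ^ (r - 1) = 1 / real k"
  proof -
    have "q ^ (r - 1) = q powr (real r - 1)"
      using assms(1,4) by (subst powr_realpow[symmetric]) (auto simp: q_def of_nat_diff)
    also have "\<dots> = 1 / real k"
      using assms(1,4) by (simp add: q_def powr_powr)
    finally show ?thesis .
  qed
  \<comment> \<open>At this \<open>q\<close> the expected number of repairs,
    \<open>(n / r) * k * q ^ r\<close>, collapses to \<open>(n / r) * q\<close>.\<close>
  then have kq: "real k * q ^ r = q"
    using assms(1,4) by (cases r) auto
  \<comment> \<open>An infinite set would have \<open>card\<close> 0, whereas \<open>n\<close> is at
    least 2.\<close>
  have finV: "finite V"
    using assms(1,2,5) by (intro card_ge_0_finite) auto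
  define m where "m = n div r"
  have mr: "real m = real n / real r"
    using assms(1,3) by (simp add: m_def real_of_nat_div mod_eq_0_iff_dvd)
  obtain H :: "nat \<Rightarrow> nat \<Rightarrow> 'a pair_pre_digraph" where H: "\<And>i. i \<in> {1..k} \<Longrightarrow>
        (\<forall>j<m. K\<^bsub>r\<^esub> (with_proj (H i j))) \<and>
        pverts (F i) = (\<Union>j<m. pverts (H i j)) \<and> parcs (F i) = (\<Union>j<m. parcs (H i j))"
    using assms(8) unfolding disjoint_union_of_cliques_def m_def by metis
  \<comment> \<open>Cliques are indexed by factor and position, so a vertex set that is a clique in
    several factors is counted once for each; there are \<open>k * m\<close> indices in all.\<close>
  define I where "I = {1..k} \<times> {..<m}"
  define B where "B = (\<lambda>(i, j). pverts (H i j))"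
  have cardB: "card (B x) = r" if "x \<in> I" for x
    using that H by (auto simp: I_def B_def complete_digraph_pair_def)
  have BV: "B x \<subseteq> V" if "x \<in> I" for x
    using that H assms(7) by (fastforce simp: I_def B_def)
  have nonempty: "B x \<noteq> {}" if "x \<in> I" for x
    using cardB[OF that] assms(1) by auto
  have finI: "finite I"
    by (simp add: I_def)
  obtain S where S: "S \<subseteq> V"
    "\<forall>x\<in>I. B x \<inter> S \<noteq> {}" "real (card S) \<le> (1 - q) * real (card V) + (\<Sum>x\<in>I. q ^ card (B x))"
    using exists_small_transversal[where I = I and B = B, OF finV finI BV nonempty q01] by blast
  have "simult_dominating_set V k F S"
  proof (rule simult_dominating_set_if_meets_cliques[where H = H and m = m and r = r])
    show "pverts (H i j) \<inter> S \<noteq> {}" if "i \<in> {1..k}" "j < m" for i j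
      using that S(2) by (auto simp: I_def B_def)
  qed (use S(1) H assms(7) in auto)
  then have "real (gamma_sd V k F) \<le> real (card S)"
    using gamma_sd_le_card finV by auto
  also have "\<dots> \<le> (1 - q) * real n + real (k * m) * q ^ r"
    using S(3) cardB assms(5) by (simp add: I_def)
  also have "real (k * m) * q ^ r = q * (real n / real r)"
    using kq mr by (metis mult.assoc mult.commute of_nat_mult)
  also have "(1 - q) * real n + q * (real n / real r) = (1 - (real r - 1) / real r * q) * real n"
    using assms(1) by (simp add: field_simps)
  finally have "real (gamma_sd V k F) \<le> (1 - (real r - 1) / real r * q) * real n" .
  moreover have "(1 - (real r - 1) / real r * q) * real n \<le> real n * (ln (real k) + 1) / real r"
  proof -
    have "q = exp (- (ln (real k) / (real r - 1)))"
      using assms(4) by (simp add: q_def powr_def ln_div)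
    then have "1 - ln (real k) / (real r - 1) \<le> q"
      using exp_ge_add_one_self[of "- (ln (real k) / (real r - 1))"] by simp
    \<comment> \<open>Clearing the positive denominator \<open>real r - 1\<close> prepares the
      rearrangement to \<open>real r - (real r - 1) * q \<le> ln (real k) + 1\<close>, which is then
      divided by \<open>r\<close> and scaled by \<open>n\<close>.\<close>
    then have "real r - 1 - ln (real k) \<le> (real r - 1) * q"
      using assms(1) by (simp add: field_simps)
    then have "(real r - (real r - 1) * q) / real r \<le> (ln (real k) + 1) / real r"
      by (intro divide_right_mono) auto
    then have "1 - (real r - 1) / real r * q \<le> (ln (real k) + 1) / real r"
      using assms(1) by (simp add: diff_divide_distrib[of "real r" "(real r - 1) * q"])
    then have "(1 - (real r - 1) / real r * q) * real n \<le> (ln (real k) + 1) / real r * real n"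
      by (rule mult_right_mono) simp
    then show ?thesis by (simp add: mult.commute)
  qed
  ultimately show ?thesis
    unfolding q_def by blast
qed

end
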